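(* Let $A\in\mathbb{R}^{m\times n}$, $m\geq n$, let $\varepsilon,\delta\in(0,1)$, and let $S\in\mathbb{R}^{s\times m}$ be a randomized $(\varepsilon,\delta,\mathrm{rank}(A))$-subspace embedding of $\mathrm{Range}(A)$, with $s\geq \mathrm{rank}(A)$. Then there exist an $S^{\top}S$-orthogonal matrix $W\in\mathbb{R}^{m\times r}$, an orthogonal matrix $V\in\mathbb{R}^{n\times r}$, with $r=\min\{s,n\}$, and a diagonal matrix $\Theta=\mathrm{diag}(\theta_1,\ldots,\theta_r)$ with $\theta_1\geq\ldots\geq\theta_r\geq 0$, such that $A$ can be written as $$A=W\Theta V^{\top},$$ where the equality holds with probability $1-\delta$.
   Context: Subspace embedding: let $\mathcal{V}$ be a $k$-dimensional subspace of $\mathbb{R}^m$, $\varepsilon\in(0,1)$ and $s\le m$. A (random) linear map $S\in\mathbb{R}^{s\times m}$ is an $(\varepsilon,\delta,k)$-subspace embedding for $\mathcal{V}$ if $(1-\varepsilon)\|v\|^2\le\|Sv\|^2\le(1+\varepsilon)\|v\|^2$ for all $v\in\mathcal{V}$ holds with probability at least $1-\delta$ (Euclidean norms). A matrix $W$ is called $S^{\top}S$-orthogonal if $W^{\top}S^{\top}SW=I$, with $I$ the identity of dimension equal to the number of columns of $W$. A (possibly tall rectangular) matrix $V$ is called orthogonal if $V^{\top}V=I$, i.e. its columns are orthonormal. Since $S$ is random, $S^{\top}S$-orthogonality and related properties are understood in the probabilistic sense induced by the embedding property. The factorization $A=W\Theta V^\top$ is called the $S^{\top}S$-SVD of $A$,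 and the $\theta_i$ are the $S^{\top}S$-singular values of $A$.
   Formalization: Added assumption: almost surely, whenever S embeds Range(A), rank(S) ≥ min{s,n}. Without it the claim fails, e.g. A = S = diag(1,0) with m = n = s = 2, where no S^T S-orthogonal W with r = 2 columns exists. *)

theory Defs
  imports "HOL-Probability.Probability"
begin

definition embeds :: "real \<Rightarrow> real^'m^'s \<Rightarrow> (real^'m) set \<Rightarrow> bool" where
  "embeds \<epsilon> S U \<longleftrightarrow>
     (\<forall>v\<in>U. (1 - \<epsilon>) * (norm v)\<^sup>2 \<le> (norm (S *v v))\<^sup>2 \<and>
             (norm (S *v v))\<^sup>2 \<le> (1 + \<epsilon>) * (norm v)\<^sup>2)"

(* For delta < 1 the last conjunct also forces the event to be measurable,
   because measure is 0 on sets that are not measurable. *)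
definition random_subspace_embedding ::
    "'w measure \<Rightarrow> real \<Rightarrow> real \<Rightarrow> nat \<Rightarrow> ('w \<Rightarrow> real^'m^'s) \<Rightarrow> (real^'m) set \<Rightarrow> bool" where
  "random_subspace_embedding M \<epsilon> \<delta> k S U \<longleftrightarrow>
     prob_space M \<and> S \<in> borel_measurable M \<and>
     subspace U \<and> dim U = k \<and>
     0 < \<epsilon> \<and> \<epsilon> < 1 \<and> CARD('s) \<le> CARD('m) \<and>
     measure M {\<omega> \<in> space M. embeds \<epsilon> (S \<omega>) U} \<ge> 1 - \<delta>"

definition StS_orthogonal :: "real^'m^'s \<Rightarrow> real^'r^'m \<Rightarrow> bool" where
  "StS_orthogonal S W \<longleftrightarrow> transpose W ** transpose S ** S ** W = mat 1"

(* Unlike the library's orthogonal_matrix, this applies to tall rectangular matrices. *)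
definition orthonormal_columns :: "real^'r^'n \<Rightarrow> bool" where
  "orthonormal_columns V \<longleftrightarrow> transpose V ** V = mat 1"

definition diag :: "('r \<Rightarrow> real) \<Rightarrow> real^'r^'r" where
  "diag \<theta> = (\<chi> i j. if i = j then \<theta> i else 0)"

end

theory Submission
  imports Defs
begin

text \<open>
  Two properties of the random matrix carry the proof, and both hold on an event of probability at
  least \<open>1 - \<delta>\<close>: the embedding inequality makes \<open>S\<close> injective on the range of \<open>A\<close>,
  and the range of \<open>S\<close> has dimension at least \<open>r = min {s, n}\<close>.

  For a fixed such \<open>S\<close>, put \<open>T = S A\<close>. Right singular vectors \<open>v\<^sub>1, v\<^sub>2, \<dots>\<close> of \<open>T\<close> are
  chosen greedily: each is a unit vector that maximizes \<open>\<parallel>T x\<parallel>\<close> among the unit vectors orthogonal to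
  its predecessors (\<open>exists_greedy_maximizers\<close>). This orders the singular values
  \<open>\<theta>\<^sub>i = \<parallel>T v\<^sub>i\<parallel>\<close>, and the first-order condition at a maximum makes the images
  \<open>T v\<^sub>i\<close> pairwise orthogonal (\<open>image_orthogonal_at_maximizer\<close>). After \<open>r\<close> steps nothing is left:
  on the orthogonal complement of \<open>v\<^sub>1, \<dots>, v\<^sub>r\<close> the map \<open>T\<close> vanishes, because a vector there with
  nonzero image would give \<open>r + 1\<close> nonzero pairwise orthogonal vectors both in \<open>\<real>\<^sup>n\<close> and in
  \<open>\<real>\<^sup>s\<close>, one of which has dimension \<open>r\<close> (\<open>exists_right_singular_vectors\<close>).

  The left factor must consist of vectors \<open>w\<^sub>i\<close> whose images under \<open>S\<close> are orthonormal. If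
  \<open>\<theta>\<^sub>i > 0\<close>, then \<open>w\<^sub>i = A v\<^sub>i / \<theta>\<^sub>i\<close> is forced. If \<open>\<theta>\<^sub>i = 0\<close>, any \<open>w\<^sub>i\<close> will do whose image
  completes the orthonormal system inside the range of \<open>S\<close>, and the rank bound leaves room
  for it (\<open>extend_orthonormal_family\<close>). Injectivity of \<open>S\<close> on the range of \<open>A\<close> carries the vanishing
  of \<open>T\<close> back to \<open>A\<close>, so that \<open>A x = (\<Sum>i. \<theta>\<^sub>i (v\<^sub>i \<bullet> x) w\<^sub>i)\<close> for every \<open>x\<close>
  (\<open>linear_sketched_SVD\<close>).

  The factors so chosen depend on the sample point in an arbitrary, possibly nonmeasurable way. The
  event in question is measurable all the same: outside the good event, \<open>W\<close> is set to \<open>0\<close>, which is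
  never \<open>S\<^sup>T S\<close>-orthogonal, so the factorization event is exactly the good event.
\<close>

section \<open>Orthogonal families\<close>

lemma orthogonal_family_vanishing:
  fixes v :: "'r::finite \<Rightarrow> 'b::euclidean_space"
  assumes nz: "\<And>i. v i \<noteq> 0" and orth: "\<And>i j. i \<noteq> j \<Longrightarrow> v i \<bullet> v j = 0"
    and card: "DIM('b) \<le> CARD('r)" and x: "\<And>i. v i \<bullet> x = 0"
  shows "x = 0"
proof -
  have inj: "inj v"
    by (rule injI) (metis orth nz inner_eq_zero_iff)
  have "pairwise orthogonal (range v)"
    unfolding pairwise_def orthogonal_def using orth by (metis imageE)
  then have "independent (range v)"
    using nz by (intro pairwise_orthogonal_independent) auto
  then have "UNIV \<subseteq> span (range v)"
    using card inj by (intro card_ge_dim_independent) (auto simp: card_image)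
  then have "x \<in> span (range v)" by auto
  then have "orthogonal x x"
    by (rule orthogonal_to_span) (use x in \<open>auto simp: orthogonal_def inner_commute[of x]\<close>)
  then show ?thesis by (simp add: orthogonal_def)
qed

lemma extend_orthonormal_family:
  fixes u :: "'r::finite \<Rightarrow> 'b::euclidean_space"
  assumes R: "subspace R" and dim: "CARD('r) \<le> dim R"
    and mem: "\<And>i. i \<in> I \<Longrightarrow> u i \<in> R"
    and orth: "\<And>i j. i \<in> I \<Longrightarrow> j \<in> I \<Longrightarrow> u i \<bullet> u j = (if i = j then 1 else 0)"
  obtains u' where "\<And>i. i \<in> I \<Longrightarrow> u' i = u i" "\<And>i. u' i \<in> R"
    "\<And>i j. u' i \<bullet> u' j = (if i = j then 1 else 0)"
proof -
  have "finite (UNIV :: 'r set)" by simp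
  then have "\<exists>u'. (\<forall>i\<in>I. u' i = u i) \<and> (\<forall>i\<in>I \<union> UNIV. u' i \<in> R) \<and>
      (\<forall>i\<in>I \<union> UNIV. \<forall>j\<in>I \<union> UNIV. u' i \<bullet> u' j = (if i = j then 1 else 0))"
  proof (induction rule: finite_induct)
    case empty
    then show ?case using mem orth by (intro exI[of _ u]) auto
  next
    case (insert a J)
    then obtain u' where u': "\<forall>i\<in>I. u' i = u i" "\<forall>i\<in>I \<union> J. u' i \<in> R"
      "\<forall>i\<in>I \<union> J. \<forall>j\<in>I \<union> J. u' i \<bullet> u' j = (if i = j then 1 else 0)"
      by blast
    show ?case
    proof (cases "a \<in> I")
      case True
      then have "I \<union> insert a J = I \<union> J" by auto
      then show ?thesis using u' by metis
    next
      case False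
      have "dim (u' ` (I \<union> J)) \<le> card (u' ` (I \<union> J))"
        by (rule dim_le_card) (auto intro: span_base)
      also have "\<dots> \<le> card (I \<union> J)" by (rule card_image_le) simp
      also have "\<dots> < CARD('r)"
        by (rule psubset_card_mono) (use False insert.hyps in auto)
      also have "\<dots> \<le> dim R" by (rule dim)
      finally have "dim (u' ` (I \<union> J)) < dim R" .
      moreover have "span (u' ` (I \<union> J)) \<subseteq> R"
        using R u'(2) by (intro span_minimal) auto
      ultimately have "span (u' ` (I \<union> J)) \<subset> span R"
        by (metis R dim_span nless_le psubsetI span_eq_iff)
      then obtain y where y: "y \<noteq> 0" "y \<in> R"
          "\<And>z. z \<in> span (u' ` (I \<union> J)) \<Longrightarrow> orthogonal y z"
        using orthogonal_to_subspace_exists_gen span_eq_iff R by metis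
      define e where "e = y /\<^sub>R norm y"
      have e: "e \<in> R" "e \<bullet> e = 1" "\<And>i. i \<in> I \<union> J \<Longrightarrow> e \<bullet> u' i = 0"
        using y R by (auto simp: e_def subspace_scale orthogonal_def span_base
            dot_square_norm power2_eq_square field_simps)
      have e': "u' i \<bullet> e = 0" if "i \<in> I \<union> J" for i
        using e(3)[OF that] by (simp add: inner_commute)
      show ?thesis
        using u' e e' False insert.hyps
        by (intro exI[of _ "u'(a := e)"]) auto
    qed
  qed
  then show ?thesis using that by auto
qed

section \<open>Greedy singular vectors\<close>

text \<open>
  Moving from \<open>u\<close> to \<open>u + t x\<close> changes \<open>\<parallel>T u\<parallel>\<^sup>2\<close> by \<open>2 t (T u \<bullet> T x)\<close> to first order, but
  changes \<open>\<parallel>u\<parallel>\<^sup>2\<close> only to second order; at a maximum of the ratio the first-order term must vanish.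
\<close>

lemma image_orthogonal_at_maximizer:
  fixes T :: "'a::real_inner \<Rightarrow> 'b::real_inner"
  assumes T: "linear T" and u: "norm u = 1" and ux: "u \<bullet> x = 0"
    and max: "\<And>t. norm (T (u + t *\<^sub>R x)) \<le> norm (T u) * norm (u + t *\<^sub>R x)"
  shows "T u \<bullet> T x = 0"
proof -
  define a where "a = T u \<bullet> T x"
  define d where "d = (norm (T u))\<^sup>2 * (x \<bullet> x) - T x \<bullet> T x"
  have ineq: "2 * t * a \<le> t\<^sup>2 * d" for t
  proof -
    have "(norm (T (u + t *\<^sub>R x)))\<^sup>2 \<le> (norm (T u) * norm (u + t *\<^sub>R x))\<^sup>2"
      by (rule power_mono[OF max]) simp
    moreover have "(norm (T (u + t *\<^sub>R x)))\<^sup>2 = (norm (T u))\<^sup>2 + 2 * t * a + t\<^sup>2 * (T x \<bullet> T x)"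
      unfolding power2_norm_eq_inner linear_add[OF T] linear_scale[OF T] a_def
      by (simp add: inner_add_left inner_add_right inner_commute[of "T x" "T u"]
          power2_eq_square distrib_left mult.assoc)
    moreover have "(norm (u + t *\<^sub>R x))\<^sup>2 = 1 + t\<^sup>2 * (x \<bullet> x)"
    proof -
      have "u \<bullet> u = 1" using u by (simp add: dot_square_norm)
      then show ?thesis
        using ux unfolding power2_norm_eq_inner
        by (simp add: inner_add_left inner_add_right inner_commute[of x u] power2_eq_square)
    qed
    ultimately show ?thesis
      by (simp add: d_def power_mult_distrib algebra_simps)
  qed
  \<comment> \<open>At \<open>t = a / D\<close> the right-hand side is at most half of the left-hand side.\<close>
  define D where "D = \<bar>d\<bar> + 1"
  have D: "D > 0" "d \<le> D" by (auto simp: D_def)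
  have "2 * (a / D) * a \<le> (a / D)\<^sup>2 * d" by (rule ineq)
  also have "\<dots> \<le> (a / D)\<^sup>2 * D" using D by (intro mult_left_mono) auto
  finally have "2 * (a\<^sup>2 / D) \<le> a\<^sup>2 / D"
    using D by (simp add: power2_eq_square)
  then have "a\<^sup>2 / D \<le> 0" by linarith
  then have "a\<^sup>2 \<le> 0" using D by (simp add: divide_le_0_iff)
  then show ?thesis by (simp add: a_def)
qed

lemma exists_norm_maximizer:
  fixes T :: "'a::euclidean_space \<Rightarrow> 'b::real_normed_vector"
  assumes T: "linear T" and U: "subspace U" and y: "y \<in> U" "y \<noteq> 0"
  shows "\<exists>u\<in>U. norm u = 1 \<and> (\<forall>x\<in>U. norm (T x) \<le> norm (T u) * norm x)"
proof -
  let ?K = "U \<inter> sphere 0 1"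
  have "compact ?K" using closed_subspace[OF U] by (simp add: closed_Int_compact)
  moreover have unit: "x /\<^sub>R norm x \<in> ?K" if "x \<in> U" "x \<noteq> 0" for x
    using that U by (simp add: subspace_scale)
  then have "?K \<noteq> {}" using y by blast
  moreover have "continuous_on ?K (\<lambda>x. norm (T x))"
    using T by (intro continuous_on_norm linear_continuous_on) (simp add: linear_conv_bounded_linear)
  ultimately obtain u where u: "u \<in> ?K" "\<And>x. x \<in> ?K \<Longrightarrow> norm (T x) \<le> norm (T u)"
    using continuous_attains_sup[of ?K "\<lambda>x. norm (T x)"] by blast
  have "norm (T x) \<le> norm (T u) * norm x" if "x \<in> U" for x
  proof (cases "x = 0")
    case False
    then show ?thesis using u(2)[OF unit[OF that False]]
      by (simp add: linear_scale[OF T] divide_simps)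
  qed (simp add: linear_0[OF T])
  then show ?thesis using u by auto
qed

lemma exists_greedy_maximizers:
  fixes T :: "'a::euclidean_space \<Rightarrow> 'b::real_normed_vector"
  assumes T: "linear T" and card: "CARD('r::{finite,linorder}) \<le> DIM('a)"
  obtains v :: "'r::{finite,linorder} \<Rightarrow> 'a" where "\<And>i. norm (v i) = 1"
    "\<And>i j. j < i \<Longrightarrow> v j \<bullet> v i = 0"
    "\<And>i x. (\<And>j. j < i \<Longrightarrow> v j \<bullet> x = 0) \<Longrightarrow> norm (T x) \<le> norm (T (v i)) * norm x"
proof -
  let ?R = "{(j, i). j < (i::'r)}"
  let ?U = "\<lambda>v (i::'r). {x::'a. \<forall>j<i. v j \<bullet> x = 0}"
  let ?P = "\<lambda>v i u. u \<in> ?U v i \<and> norm u = 1 \<and> (\<forall>x \<in> ?U v i. norm (T x) \<le> norm (T u) * norm x)"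
  \<comment> \<open>The choice at \<open>i\<close> depends on the earlier ones, so this is a choice by recursion along the order.\<close>
  have "\<exists>v. \<forall>i. ?P v i (v i)"
  proof (rule dependent_wf_choice[of ?R ?P])
    have "?R \<subseteq> Wellfounded.measure (\<lambda>i. card {..<i})"
      by (auto intro!: psubset_card_mono)
    then show "wf ?R" by (rule wf_subset[OF wf_measure])
  next
    fix f g :: "'r \<Rightarrow> 'a" and i r assume "\<And>j. (j, i) \<in> ?R \<Longrightarrow> f j = g j"
    then have "?U f i = ?U g i" by auto
    then show "?P f i r = ?P g i r" by simp
  next
    fix v :: "'r \<Rightarrow> 'a" and i
    have "dim (v ` {..<i}) \<le> card (v ` {..<i})"
      by (rule dim_le_card) (auto intro: span_base)
    also have "\<dots> \<le> card {..<i}" by (rule card_image_le) simp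
    also have "\<dots> < CARD('r)" by (rule psubset_card_mono) auto
    also have "\<dots> \<le> DIM('a)" by (rule card)
    finally obtain y where y: "y \<noteq> 0" "\<And>z. z \<in> span (v ` {..<i}) \<Longrightarrow> orthogonal y z"
      using orthogonal_to_subspace_exists by blast
    then have "y \<in> ?U v i" by (auto simp: orthogonal_def inner_commute[of _ y] span_base)
    moreover have "subspace (?U v i)"
      by (auto simp: subspace_def inner_add_right)
    ultimately show "\<exists>u. ?P v i u"
      using exists_norm_maximizer[OF T _ _ y(1)] by blast
  qed
  then show ?thesis using that by auto
qed

text \<open>
  A vector \<open>x\<close> orthogonal to all \<open>v i\<close> with \<open>T x \<noteq> 0\<close> competed in every maximization, so all
  \<open>T (v i)\<close> are nonzero as well. But whichever of \<open>'a\<close> and \<open>'b\<close> has dimension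
  \<open>CARD('r)\<close> has no room for one more orthogonal direction.
\<close>

lemma exists_right_singular_vectors:
  fixes T :: "'a::euclidean_space \<Rightarrow> 'b::euclidean_space"
  assumes T: "linear T" and card: "CARD('r::{finite,linorder}) = min (DIM('b)) (DIM('a))"
  obtains v :: "'r::{finite,linorder} \<Rightarrow> 'a" where
    "\<And>i j. v i \<bullet> v j = (if i = j then 1 else 0)"
    "\<And>i j. i \<noteq> j \<Longrightarrow> T (v i) \<bullet> T (v j) = 0"
    "\<And>i j. i \<le> j \<Longrightarrow> norm (T (v j)) \<le> norm (T (v i))"
    "\<And>x. (\<And>i. v i \<bullet> x = 0) \<Longrightarrow> T x = 0"
proof -
  obtain v :: "'r \<Rightarrow> 'a" where unit: "\<And>i. norm (v i) = 1"
    and less: "\<And>i j. j < i \<Longrightarrow> v j \<bullet> v i = 0"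
    and max: "\<And>i x. (\<And>j. j < i \<Longrightarrow> v j \<bullet> x = 0) \<Longrightarrow> norm (T x) \<le> norm (T (v i)) * norm x"
    using exists_greedy_maximizers[OF T] card by (metis min.cobounded2)
  have orth: "v i \<bullet> v j = 0" if "i \<noteq> j" for i j
    using that less by (metis inner_commute neqE)
  have nz: "v i \<noteq> 0" for i using unit[of i] by auto
  have image_orth: "T (v i) \<bullet> T x = 0" if "\<And>j. j \<le> i \<Longrightarrow> v j \<bullet> x = 0" for i x
    using that less[of _ i]
    by (intro image_orthogonal_at_maximizer[OF T unit] max) (auto simp: inner_add_right)
  have image_orth': "T (v i) \<bullet> T (v j) = 0" if "i \<noteq> j" for i j
    using that image_orth[of i "v j"] image_orth[of j "v i"] less
    by (metis inner_commute le_less_trans neqE)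
  have vanish: "T x = 0" if x: "\<And>i. v i \<bullet> x = 0" for x
  proof (rule ccontr)
    assume Tx: "T x \<noteq> 0"
    have Tv: "T (v i) \<noteq> 0" for i
    proof
      assume "T (v i) = 0"
      then show False using max[of i x] x Tx by simp
    qed
    have "DIM('a) \<le> CARD('r) \<or> DIM('b) \<le> CARD('r)" using card by linarith
    then show False
    proof
      assume "DIM('a) \<le> CARD('r)"
      then have "x = 0"
        by (rule orthogonal_family_vanishing[rotated 2, where v = v])
          (use x orth nz in auto)
      then show False using Tx linear_0[OF T] by simp
    next
      assume "DIM('b) \<le> CARD('r)"
      then have "T x = 0"
        by (rule orthogonal_family_vanishing[rotated 2, where v = "\<lambda>i. T (v i)"])
          (use x Tv image_orth image_orth' in auto)
      then show False using Tx by simp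
    qed
  qed
  have orthonormal: "v i \<bullet> v j = (if i = j then 1 else 0)" for i j
    using orth unit by (simp add: dot_square_norm)
  have mono: "norm (T (v j)) \<le> norm (T (v i))" if "i \<le> j" for i j
    using max[of i "v j"] less that unit by simp
  show ?thesis by (rule that[of v]) (fact orthonormal image_orth' mono vanish)+
qed

section \<open>The decomposition for a fixed embedding\<close>

text \<open>
  Here \<open>f\<close> and \<open>g\<close> stand for \<open>A\<close> and \<open>S\<close>. The vector \<open>x\<close> splits into its projection
  onto the span of the \<open>v i\<close> and a rest that \<open>g \<circ> f\<close>, hence also \<open>f\<close>, sends to zero.
\<close>

lemma linear_sketched_SVD:
  fixes f :: "'a::euclidean_space \<Rightarrow> 'b::euclidean_space"
    and g :: "'b \<Rightarrow> 'c::euclidean_space"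
    and v :: "'r::finite \<Rightarrow> 'a"
  assumes f: "linear f" and g: "linear g"
    and inj: "\<And>x. g (f x) = 0 \<Longrightarrow> f x = 0"
    and rank: "CARD('r) \<le> dim (range g)"
    and v: "\<And>i j. v i \<bullet> v j = (if i = j then 1 else 0)"
    and orth: "\<And>i j. i \<noteq> j \<Longrightarrow> g (f (v i)) \<bullet> g (f (v j)) = 0"
    and vanish: "\<And>x. (\<And>i. v i \<bullet> x = 0) \<Longrightarrow> g (f x) = 0"
  shows "\<exists>w. (\<forall>i j. g (w i) \<bullet> g (w j) = (if i = j then 1 else 0)) \<and>
    (\<forall>x. f x = (\<Sum>i\<in>UNIV. (norm (g (f (v i))) * (v i \<bullet> x)) *\<^sub>R w i))"
proof -
  define \<theta> where "\<theta> i = norm (g (f (v i)))" for i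
  define I where "I = {i. \<theta> i \<noteq> 0}"
  have "subspace (range g)" using linear_subspace_image[OF g subspace_UNIV] .
  then obtain u where u: "\<And>i. i \<in> I \<Longrightarrow> u i = g (f (v i)) /\<^sub>R \<theta> i" "\<And>i. u i \<in> range g"
    "\<And>i j. u i \<bullet> u j = (if i = j then 1 else 0)"
  proof (rule extend_orthonormal_family[OF _ rank, of I "\<lambda>i. g (f (v i)) /\<^sub>R \<theta> i"])
    show "g (f (v i)) /\<^sub>R \<theta> i \<in> range g" for i
      by (metis linear_scale[OF g] rangeI)
    show "(g (f (v i)) /\<^sub>R \<theta> i) \<bullet> (g (f (v j)) /\<^sub>R \<theta> j) = (if i = j then 1 else 0)"
      if "i \<in> I" "j \<in> I" for i j
      using that orth[of i j]
      by (auto simp: I_def \<theta>_def dot_square_norm power2_eq_square field_simps)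
  qed blast
  have "\<exists>w. g w = u i \<and> (i \<in> I \<longrightarrow> w = f (v i) /\<^sub>R \<theta> i)" for i
  proof (cases "i \<in> I")
    case True
    then show ?thesis using u(1)[of i] by (simp add: linear_scale[OF g])
  next
    case False
    then show ?thesis using u(2)[of i] by (metis imageE)
  qed
  then obtain w where w: "\<And>i. g (w i) = u i" "\<And>i. i \<in> I \<Longrightarrow> w i = f (v i) /\<^sub>R \<theta> i"
    by metis
  have fv: "f (v i) = \<theta> i *\<^sub>R w i" for i
  proof (cases "i \<in> I")
    case True
    then show ?thesis using w(2)[OF True] by (simp add: I_def)
  next
    case False
    then show ?thesis using inj[of "v i"] by (simp add: I_def \<theta>_def)
  qed
  have "f x = (\<Sum>i\<in>UNIV. (\<theta> i * (v i \<bullet> x)) *\<^sub>R w i)" for x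
  proof -
    let ?p = "\<Sum>i\<in>UNIV. (v i \<bullet> x) *\<^sub>R v i"
    have "v i \<bullet> (x - ?p) = 0" for i
      by (simp add: inner_diff_right inner_sum_right v if_distrib cong: if_cong)
    then have "f (x - ?p) = 0" by (intro inj vanish)
    then have "f x = f ?p" by (simp add: linear_diff[OF f])
    also have "\<dots> = (\<Sum>i\<in>UNIV. (v i \<bullet> x) *\<^sub>R f (v i))"
      by (simp add: linear_sum[OF f] linear_scale[OF f])
    finally show ?thesis by (simp add: fv mult.commute)
  qed
  note expansion = this[unfolded \<theta>_def]
  have "g (w i) \<bullet> g (w j) = (if i = j then 1 else 0)" for i j
    unfolding w(1) by (rule u(3))
  then show ?thesis by (intro exI[of _ w] conjI allI expansion)
qed

text \<open>
  Orthonormality of \<open>V\<close> and the order of \<open>\<theta>\<close> stand outside the implication because they are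
  required at every sample point, also where the embedding fails.
\<close>

lemma exists_StS_SVD:
  fixes A :: "real^'n^'m" and S :: "real^'m^'s"
  assumes card: "CARD('r::{finite,linorder}) = min CARD('s) CARD('n)" and \<epsilon>: "\<epsilon> < 1"
  shows "\<exists>(V :: real^('r::{finite,linorder})^'n) \<theta> W.
    orthonormal_columns V \<and> (\<forall>i j. i \<le> j \<longrightarrow> \<theta> j \<le> \<theta> i) \<and> (\<forall>i. 0 \<le> \<theta> i) \<and>
    (embeds \<epsilon> S (range (\<lambda>x. A *v x)) \<and> CARD('r::{finite,linorder}) \<le> rank S \<longrightarrow>
       StS_orthogonal S W \<and> A = W ** diag \<theta> ** transpose V)"
proof -
  let ?T = "\<lambda>x. S *v (A *v x)"
  have T: "linear ?T"
    using matrix_vector_mul_linear[of "S ** A"] by (simp add: matrix_vector_mul_assoc)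
  have card': "CARD('r) = min (DIM(real^'s)) (DIM(real^'n))" using card by simp
  obtain v :: "'r \<Rightarrow> real^'n" where v: "\<And>i j. v i \<bullet> v j = (if i = j then 1 else 0)"
    and orth: "\<And>i j. i \<noteq> j \<Longrightarrow> ?T (v i) \<bullet> ?T (v j) = 0"
    and mono: "\<And>i j. i \<le> j \<Longrightarrow> norm (?T (v j)) \<le> norm (?T (v i))"
    and vanish: "\<And>x. (\<And>i. v i \<bullet> x = 0) \<Longrightarrow> ?T x = 0"
    by (rule exists_right_singular_vectors[OF T card']) blast
  define V :: "real^('r::{finite,linorder})^'n" where "V = (\<chi> i j. v j $ i)"
  define \<theta> where "\<theta> i = norm (?T (v i))" for i
  have "orthonormal_columns V"
    using v by (simp add: orthonormal_columns_def matrix_matrix_mult_def transpose_def V_def mat_def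
        vec_eq_iff inner_vec_def)
  moreover have "\<exists>W. StS_orthogonal S W \<and> A = W ** diag \<theta> ** transpose V"
    if emb: "embeds \<epsilon> S (range (\<lambda>x. A *v x))" and rank: "CARD('r) \<le> rank S"
  proof -
    have inj: "A *v x = 0" if "?T x = 0" for x
    proof -
      have "(1 - \<epsilon>) * (norm (A *v x))\<^sup>2 \<le> (norm (?T x))\<^sup>2"
        using emb unfolding embeds_def by blast
      then show ?thesis using \<epsilon> that by (simp add: mult_le_0_iff)
    qed
    have "\<exists>w. (\<forall>i j. (S *v w i) \<bullet> (S *v w j) = (if i = j then 1 else 0)) \<and>
        (\<forall>x. A *v x = (\<Sum>i\<in>UNIV. (\<theta> i * (v i \<bullet> x)) *\<^sub>R w i))"
      unfolding \<theta>_def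
    proof (rule linear_sketched_SVD[of "\<lambda>x. A *v x" "\<lambda>x. S *v x" v])
      show "CARD('r) \<le> dim (range (\<lambda>x. S *v x))" using rank by (simp add: rank_dim_range)
    qed (fact matrix_vector_mul_linear inj v orth vanish)+
    then obtain w :: "'r \<Rightarrow> real^'m"
      where w: "\<And>i j. (S *v w i) \<bullet> (S *v w j) = (if i = j then 1 else 0)"
        "\<And>x. A *v x = (\<Sum>i\<in>UNIV. (\<theta> i * (v i \<bullet> x)) *\<^sub>R w i)"
      by blast
    define W :: "real^('r::{finite,linorder})^'m" where "W = (\<chi> i j. w j $ i)"
    have SW: "(S ** W) $ k $ j = (S *v w j) $ k" for k j
      by (simp add: matrix_matrix_mult_def matrix_vector_mult_def W_def)
    have "transpose (S ** W) ** (S ** W) = mat 1"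
      using w(1) unfolding matrix_matrix_mult_def[of "transpose _"]
      by (simp add: transpose_def SW mat_def vec_eq_iff inner_vec_def)
    then have "StS_orthogonal S W"
      by (simp add: StS_orthogonal_def matrix_transpose_mul matrix_mul_assoc)
    moreover have "A *v x = (W ** diag \<theta> ** transpose V) *v x" for x
    proof -
      have Vx: "transpose V *v x = (\<chi> i. v i \<bullet> x)"
        by (simp add: matrix_vector_mult_def transpose_def V_def inner_vec_def)
      have Dx: "diag \<theta> *v y = (\<chi> i. \<theta> i * y $ i)" for y
        by (simp add: matrix_vector_mult_def diag_def if_distrib[of "\<lambda>z. z * _"] cong: if_cong)
      show ?thesis
        unfolding w(2) matrix_vector_mul_assoc[symmetric] Vx Dx
        by (simp add: matrix_vector_mult_def W_def vec_eq_iff mult.commute)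
    qed
    then have "A = W ** diag \<theta> ** transpose V" by (simp add: matrix_eq)
    ultimately show ?thesis by blast
  qed
  moreover have "\<forall>i j. i \<le> j \<longrightarrow> \<theta> j \<le> \<theta> i" "\<forall>i. 0 \<le> \<theta> i"
    using mono by (auto simp: \<theta>_def)
  ultimately show ?thesis by blast
qed

lemma not_StS_orthogonal_0: "\<not> StS_orthogonal (S :: real^'m^'s) (0 :: real^'r^'m)"
proof
  assume "StS_orthogonal S (0 :: real^'r^'m)"
  then have "mat 1 = (0 :: real^'r^'r)"
    by (auto simp: StS_orthogonal_def)
  then have "(mat 1 :: real^'r^'r) $ undefined $ undefined = 0"
    by simp
  then show False
    by (simp add: mat_def)
qed

section \<open>The randomized decomposition\<close>

theorem theorem1:
  fixes A :: "real^'n^'m"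
    and M :: "'w measure"
    and S :: "'w \<Rightarrow> real^'m^'s"
    and \<epsilon> \<delta> :: real
  assumes "CARD('n) \<le> CARD('m)"
    and "0 < \<epsilon>" "\<epsilon> < 1" "0 < \<delta>" "\<delta> < 1"
    and "random_subspace_embedding M \<epsilon> \<delta> (rank A) S (range (\<lambda>x. A *v x))"
    and "rank A \<le> CARD('s)"
    and "CARD('r::{finite,linorder}) = min CARD('s) CARD('n)"
    and "AE \<omega> in M. embeds \<epsilon> (S \<omega>) (range (\<lambda>x. A *v x)) \<longrightarrow>
           min CARD('s) CARD('n) \<le> rank (S \<omega>)"
  shows "\<exists>(W :: 'w \<Rightarrow> real^('r::{finite,linorder})^'m)
            (V :: 'w \<Rightarrow> real^('r::{finite,linorder})^'n)
            (\<theta> :: 'w \<Rightarrow> ('r::{finite,linorder}) \<Rightarrow> real).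
           (\<forall>\<omega>\<in>space M. orthonormal_columns (V \<omega>) \<and>
              (\<forall>i j. i \<le> j \<longrightarrow> \<theta> \<omega> i \<ge> \<theta> \<omega> j) \<and> (\<forall>i. \<theta> \<omega> i \<ge> 0)) \<and>
           measure M {\<omega> \<in> space M. StS_orthogonal (S \<omega>) (W \<omega>) \<and>
              A = W \<omega> ** diag (\<theta> \<omega>) ** transpose (V \<omega>)} \<ge> 1 - \<delta>"
proof -
  let ?E = "{\<omega> \<in> space M. embeds \<epsilon> (S \<omega>) (range (\<lambda>x. A *v x))}"
  interpret prob_space M using assms(6) by (simp add: random_subspace_embedding_def)
  have prob_E: "1 - \<delta> \<le> measure M ?E" using assms(6) by (simp add: random_subspace_embedding_def)
  \<comment> \<open>A set outside the sigma algebra has measure \<open>0\<close>, which is below \<open>1 - \<delta>\<close>.\<close>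
  have E: "?E \<in> sets M"
  proof (rule ccontr)
    assume "?E \<notin> sets M"
    then have "measure M ?E = 0" by (rule measure_notin_sets)
    then show False using prob_E \<open>\<delta> < 1\<close> by simp
  qed
  obtain N where N: "N \<in> null_sets M"
    "{\<omega> \<in> space M. \<not> (embeds \<epsilon> (S \<omega>) (range (\<lambda>x. A *v x)) \<longrightarrow>
       min CARD('s) CARD('n) \<le> rank (S \<omega>))} \<subseteq> N"
    using assms(9) by (auto elim!: AE_E simp: null_sets_def)
  \<comment> \<open>Removing a null set that covers the exceptional points, rather than these points
     themselves, makes \<open>G\<close> measurable without a study of the measurability of the rank.\<close>
  define G where "G = ?E - N"
  have G: "G \<in> sets M" "measure M G = measure M ?E"
    using E N(1) by (auto simp: G_def measure_Diff_null_set)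
  have "\<exists>(V :: real^('r::{finite,linorder})^'n) \<theta> W.
      orthonormal_columns V \<and> (\<forall>i j. i \<le> j \<longrightarrow> \<theta> j \<le> \<theta> i) \<and> (\<forall>i. 0 \<le> \<theta> i) \<and>
      (StS_orthogonal (S \<omega>) W \<and> A = W ** diag \<theta> ** transpose V \<longleftrightarrow> \<omega> \<in> G)"
    (is "\<exists>(V :: real^('r::{finite,linorder})^'n) \<theta> W. ?Q \<omega> V \<theta> W") for \<omega>
  proof -
    obtain V :: "real^('r::{finite,linorder})^'n" and \<theta> W where svd: "orthonormal_columns V"
      "\<forall>i j. i \<le> j \<longrightarrow> \<theta> j \<le> \<theta> i" "\<forall>i. 0 \<le> \<theta> i"
      "embeds \<epsilon> (S \<omega>) (range (\<lambda>x. A *v x)) \<and> CARD('r) \<le> rank (S \<omega>) \<longrightarrow>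
         StS_orthogonal (S \<omega>) W \<and> A = W ** diag \<theta> ** transpose V"
      using exists_StS_SVD[OF assms(8) \<open>\<epsilon> < 1\<close>, where A = A and S = "S \<omega>"]
      by (elim exE conjE) (rule that)
    show ?thesis
    proof (cases "\<omega> \<in> G")
      case True
      then have "embeds \<epsilon> (S \<omega>) (range (\<lambda>x. A *v x))" "CARD('r) \<le> rank (S \<omega>)"
        using N(2) assms(8) by (auto simp: G_def)
      then have "?Q \<omega> V \<theta> W" using svd True by blast
      then show ?thesis by (intro exI[of _ V] exI[of _ \<theta>] exI[of _ W])
    next
      case False
      then have "?Q \<omega> V \<theta> 0" using svd(1-3) not_StS_orthogonal_0 by blast
      then show ?thesis by (intro exI[of _ V] exI[of _ \<theta>] exI[of _ 0])
    qed
  qed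
  then have "\<forall>\<omega>. \<exists>V \<theta> W. ?Q \<omega> V \<theta> W" by (rule allI)
  then have "\<exists>V \<theta> W. \<forall>\<omega>. ?Q \<omega> (V \<omega>) (\<theta> \<omega>) (W \<omega>)"
    unfolding choice_iff .
  then obtain V \<theta> W where Q: "\<forall>\<omega>. ?Q \<omega> (V \<omega>) (\<theta> \<omega>) (W \<omega>)"
    by (elim exE) (rule that)
  have factorization_iff: "StS_orthogonal (S \<omega>) (W \<omega>) \<and>
      A = W \<omega> ** diag (\<theta> \<omega>) ** transpose (V \<omega>) \<longleftrightarrow> \<omega> \<in> G" for \<omega>
    using spec[OF Q, of \<omega>] by (elim conjE)
  have "{\<omega> \<in> space M. StS_orthogonal (S \<omega>) (W \<omega>) \<and>
      A = W \<omega> ** diag (\<theta> \<omega>) ** transpose (V \<omega>)} = G"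
    unfolding factorization_iff using sets.sets_into_space[OF G(1)] by blast
  then have prob_factorization: "1 - \<delta> \<le> measure M {\<omega> \<in> space M. StS_orthogonal (S \<omega>) (W \<omega>) \<and>
      A = W \<omega> ** diag (\<theta> \<omega>) ** transpose (V \<omega>)}"
    using G(2) prob_E by (simp only:)
  have factors: "orthonormal_columns (V \<omega>) \<and> (\<forall>i j. i \<le> j \<longrightarrow> \<theta> \<omega> i \<ge> \<theta> \<omega> j) \<and>
      (\<forall>i. \<theta> \<omega> i \<ge> 0)" for \<omega>
    using spec[OF Q, of \<omega>] by (elim conjE) (intro conjI)
  show ?thesis
    by (rule exI[of _ W], rule exI[of _ V], rule exI[of _ \<theta>], rule conjI[OF ballI])
      (rule factors prob_factorization)+
qed

end
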